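(* Let $w$ be a recurrent infinite word. If for each $m\geq 1$ there exist $n\geq m$ and $0\leq i\leq n-m$ such that $G_n(w)$ has an element $\sigma$ that contains the independent cycle $((i+1)\,(i+2)\,\dots\,(i+m))$, then $w$ is universal.
   Context: An infinite word is a one-sided sequence $w=w_1w_2\cdots$ of letters from a finite alphabet. $F(w)$ denotes the set of all (finite) factors of $w$ and $F_n(w)$ the set of factors of length $n$. The word $w$ is recurrent if each of its factors occurs infinitely often in $w$. A permutation $g\in S_n$ acts on a word $u=u_1\cdots u_n$ by $g(u)=u_{g^{-1}(1)}\cdots u_{g^{-1}(n)}$. The symmetry group of order $n$ of $w$ is $G_n(w)=\{\pi\in S_n \mid \pi(x)\in F_n(w)\text{ for each }x\in F_n(w)\}$. The cycle $(m_1m_2\ldots m_k)$ sends $m_i$ to $m_{i+1}$ (and $m_k$ to $m_1$). A permutation $\sigma$ contains an independent cycle if that cycle is one of the cycles in the decomposition of $\sigma$ into disjoint cycles. The word $w$ is universal if $F(w)=\Sigma^*$, where $\Sigma$ is the set of letters occurring in $w$. *)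

theory Defs
  imports "HOL-Library.Omega_Words_Fun" "HOL-Combinatorics.Permutations"
    "HOL-Combinatorics.Cycles"
begin

text \<open>
  The one-sided infinite word whose letters are usually numbered from 1 is here a function on the
  naturals whose value at 0 is the first letter.  Positions in finite words and the
  points moved by permutations are likewise numbered from 0, so that the symmetric group on
  \<open>n\<close> points consists of the permutations of \<open>{..<n}\<close>.
\<close>

definition factors_of_length :: "nat \<Rightarrow> 'a word \<Rightarrow> 'a list set" where
  "factors_of_length n w = {w [k \<rightarrow> k + n] | k. True}"

definition factors :: "'a word \<Rightarrow> 'a list set" where
  "factors w = (\<Union>n. factors_of_length n w)"

definition recurrent :: "'a word \<Rightarrow> bool" where
  "recurrent w \<longleftrightarrow> (\<forall>u \<in> factors w. infinite {k. w [k \<rightarrow> k + length u] = u})"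

definition universal :: "'a word \<Rightarrow> bool" where
  "universal w \<longleftrightarrow> factors w = lists (range w)"

text \<open>
  \<open>permute_list f u\<close> has the letter \<open>u ! f j\<close> at position \<open>j\<close>, whence the inverse.
\<close>

definition perm_action :: "(nat \<Rightarrow> nat) \<Rightarrow> 'a list \<Rightarrow> 'a list" where
  "perm_action g u = permute_list (inv g) u"

definition symmetry_group :: "nat \<Rightarrow> 'a word \<Rightarrow> (nat \<Rightarrow> nat) set" where
  "symmetry_group n w = {\<pi>. \<pi> permutes {..<n} \<and>
     (\<forall>x \<in> factors_of_length n w. perm_action \<pi> x \<in> factors_of_length n w)}"

text \<open>
  Fixed points are listed as cycles of length 1, so the cycles partition \<open>S\<close>.
\<close>

definition disjoint_cycle_decomposition :: "'b set \<Rightarrow> ('b \<Rightarrow> 'b) \<Rightarrow> 'b list list \<Rightarrow> bool" where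
  "disjoint_cycle_decomposition S \<sigma> css \<longleftrightarrow>
     [] \<notin> set css \<and> distinct (concat css) \<and> set (concat css) = S \<and>
     \<sigma> = foldr (\<circ>) (map cycle_of_list css) id"

text \<open>
  The decomposition is unique only up to the order of the cycles and the choice of the first
  point of each, hence the existential quantifier.
\<close>

definition contains_independent_cycle :: "'b set \<Rightarrow> ('b \<Rightarrow> 'b) \<Rightarrow> 'b list \<Rightarrow> bool" where
  "contains_independent_cycle S \<sigma> cs \<longleftrightarrow>
     (\<exists>css. disjoint_cycle_decomposition S \<sigma> css \<and> cs \<in> set css)"

end

theory Submission
  imports Defs
begin

text \<open>
  Cycles of every length \<open>m\<close> acting on an inner window, together with recurrence (which lets every
  factor be placed in that window), make the set of factors closed under rotation.  For factors \<open>u\<close>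
  and \<open>v\<close>, recurrence gives a factor \<open>v z u\<close>; rotating it to \<open>u v z\<close> shows that \<open>u v\<close> is a factor.
  So the factors form a monoid that contains all letters.
\<close>

lemma subsequence_split:
  fixes w :: "'a word"
  assumes "i \<le> j" and "j \<le> k"
  shows "w [i \<rightarrow> k] = w [i \<rightarrow> j] @ w [j \<rightarrow> k]"
  using assms upt_add_eq_append[of i j "k - j"] by (simp add: subsequence_def)

lemma factors_iff: "u \<in> factors w \<longleftrightarrow> (\<exists>k. w [k \<rightarrow> k + length u] = u)"
  unfolding factors_def factors_of_length_def by (auto, metis)

lemma subsequence_in_factors: "w [i \<rightarrow> j] \<in> factors w"
proof (cases "i \<le> j")
  case True
  then show ?thesis
    by (auto simp: factors_iff intro!: exI[of _ i])
next
  \<comment> \<open>For \<open>j < i\<close> the subsequence is the empty word, which is a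
    factor.\<close>
  case False
  then show ?thesis
    by (auto simp: factors_iff)
qed

lemma factors_appendD1:
  assumes "u @ v \<in> factors w"
  shows "u \<in> factors w"
proof -
  obtain k where "w [k \<rightarrow> k + length u + length v] = u @ v"
    using assms by (auto simp: factors_iff add.assoc)
  moreover have "w [k \<rightarrow> k + length u + length v] =
      w [k \<rightarrow> k + length u] @ w [k + length u \<rightarrow> k + length u + length v]"
    by (intro subsequence_split) auto
  ultimately have "w [k \<rightarrow> k + length u] = u"
    by simp
  then show ?thesis
    by (auto simp: factors_iff)
qed

lemma recurrent_occurrence_ge:
  assumes "recurrent w" and "u \<in> factors w"
  obtains k where "k \<ge> l" and "w [k \<rightarrow> k + length u] = u"
  using assms unfolding recurrent_def infinite_nat_iff_unbounded_le by blast

text \<open>Reading the image at position \<open>\<sigma> p\<close> cancels the inverse in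
  \<open>perm_action\<close>: letters move along \<open>\<sigma>\<close>.\<close>

lemma perm_action_nth:
  assumes "\<sigma> permutes {..<length x}" and "p < length x"
  shows "perm_action \<sigma> x ! \<sigma> p = x ! p"
proof -
  have "\<sigma> p < length x"
    using assms permutes_in_image[OF assms(1), of p] by simp
  then show ?thesis
    unfolding perm_action_def
    using assms permutes_inv[OF assms(1)]
    by (simp add: permute_list_nth permutes_inverses)
qed

lemma foldr_cycle_of_list_fixes:
  assumes "p \<notin> set (concat css)"
  shows "foldr (\<circ>) (map cycle_of_list css) id p = p"
  using assms by (induction css) (auto simp: id_outside_supp)

text \<open>By disjointness, the cycles applied before \<open>cs\<close> fix \<open>p\<close> and
  those applied after it fix the image of \<open>p\<close>, which stays in
  \<open>set cs\<close>.\<close>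

lemma contains_independent_cycle_apply:
  assumes "contains_independent_cycle S \<sigma> cs" and "p \<in> set cs"
  shows "\<sigma> p = cycle_of_list cs p"
proof -
  obtain css where css: "disjoint_cycle_decomposition S \<sigma> css" "cs \<in> set css"
    using assms(1) unfolding contains_independent_cycle_def by blast
  then obtain as bs where split: "css = as @ cs # bs"
    by (meson split_list)
  have \<sigma>: "\<sigma> = foldr (\<circ>) (map cycle_of_list css) id" and "distinct (concat css)"
    using css(1) unfolding disjoint_cycle_decomposition_def by auto
  then have disj: "set cs \<inter> set (concat as) = {}" "set cs \<inter> set (concat bs) = {}"
    by (auto simp: split)
  let ?f = "\<lambda>css. foldr (\<circ>) (map cycle_of_list css) id"
  have app: "?f (xs @ ys) = ?f xs \<circ> ?f ys" for xs ys :: "'a list list"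
    by (induction xs) auto
  have "cycle_of_list cs p \<in> set cs"
    using assms(2) permutes_in_image[OF cycle_permutes] by metis
  then have "?f as (cycle_of_list cs p) = cycle_of_list cs p"
    using disj(1) by (intro foldr_cycle_of_list_fixes) auto
  moreover have "?f bs p = p"
    using disj(2) assms(2) by (intro foldr_cycle_of_list_fixes) auto
  ultimately show ?thesis
    unfolding \<sigma> split app by simp
qed

text \<open>Mapping a cycle over its own list of points rotates that list by one; this is entry
  \<open>j\<close> of the rotated list.\<close>

lemma cycle_of_list_upt:
  assumes "j < m"
  shows "cycle_of_list [i..<i + m] (i + j) = i + Suc j mod m"
proof -
  have "map (cycle_of_list [i..<i + m]) [i..<i + m] = rotate 1 [i..<i + m]"
    using cyclic_rotation[of "[i..<i + m]" 1] by simp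
  then have "map (cycle_of_list [i..<i + m]) [i..<i + m] ! j = rotate 1 [i..<i + m] ! j"
    by simp
  then show ?thesis
    using assms by (simp add: nth_rotate1 nth_rotate)
qed

text \<open>In a factor of length \<open>n\<close> carrying \<open>v @ [a]\<close> at offset
  \<open>i\<close>, \<open>\<sigma>\<close> shifts the letters of this window cyclically one place
  to the right, and the image is again a factor.\<close>

lemma factors_rotate_last:
  assumes "recurrent w"
    and "\<sigma> \<in> symmetry_group n w"
    and "contains_independent_cycle {..<n} \<sigma> [i..<i + m]"
    and "i + m \<le> n"
    and "m = Suc (length v)"
    and "v @ [a] \<in> factors w"
  shows "a # v \<in> factors w"
proof -
  \<comment> \<open>An occurrence starting at \<open>l \<ge> i\<close> leaves room for the factor of
    length \<open>n\<close> to start at \<open>k = l - i\<close>.\<close>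
  obtain l where "l \<ge> i" and "w [l \<rightarrow> l + length (v @ [a])] = v @ [a]"
    using recurrent_occurrence_ge[OF assms(1,6)] .
  then obtain k where k: "w [k + i \<rightarrow> k + i + m] = v @ [a]"
    using assms(5) by (metis le_add_diff_inverse2 length_append_singleton)
  have perm: "\<sigma> permutes {..<n}"
    and closed: "perm_action \<sigma> (w [k \<rightarrow> k + n]) \<in> factors_of_length n w"
    using assms(2) unfolding symmetry_group_def factors_of_length_def by auto
  obtain k' where k': "perm_action \<sigma> (w [k \<rightarrow> k + n]) = w [k' \<rightarrow> k' + n]"
    using closed unfolding factors_of_length_def by auto
  have shift: "w (k' + i + Suc j mod m) = (v @ [a]) ! j" if "j < m" for j
  proof -
    have "\<sigma> (i + j) = i + Suc j mod m"
      using contains_independent_cycle_apply[OF assms(3)] cycle_of_list_upt[OF that] that by simp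
    moreover have "i + Suc j mod m < n"
      using assms(4,5) mod_less_divisor[of m "Suc j"] by linarith
    ultimately have "w (k' + i + Suc j mod m) = w (k + (i + j))"
      using perm_action_nth[of \<sigma> "w [k \<rightarrow> k + n]" "i + j"] perm that assms(4)
      unfolding k' by (simp add: add.assoc)
    also have "\<dots> = w [k + i \<rightarrow> k + i + m] ! j"
      using that by (simp add: add.assoc)
    finally show ?thesis
      unfolding k .
  qed
  have "w (k' + i + j) = (a # v) ! j" if "j < m" for j
  proof (cases j)
    case 0
    then show ?thesis
      \<comment> \<open>The last window index \<open>length v\<close> wraps around to 0, bringing
        \<open>a\<close> to the front.\<close>
      using shift[of "length v"] assms(5) by simp
  next
    case (Suc p)
    then have "w (k' + i + j) = (v @ [a]) ! p"
      using shift[of p] that by simp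
    then show ?thesis
      using Suc that assms(5) by (simp add: nth_append)
  qed
  then have "w [k' + i \<rightarrow> k' + i + m] = a # v"
    by (intro nth_equalityI) (simp_all add: assms(5)[symmetric])
  then show ?thesis
    using subsequence_in_factors by metis
qed

theorem proposition4:
  fixes w :: "'a word"
  assumes "finite (range w)"
    and "recurrent w"
    and "\<And>m. m \<ge> 1 \<Longrightarrow> \<exists>n \<ge> m. \<exists>i \<le> n - m. \<exists>\<sigma> \<in> symmetry_group n w.
           contains_independent_cycle {..<n} \<sigma> [i..<i + m]"
  shows "universal w"
proof -
  have rot1: "a # v \<in> factors w" if "v @ [a] \<in> factors w" for a v
  proof -
    \<comment> \<open>The cycle length is chosen as the length of the whole word
      \<open>v @ [a]\<close>.\<close>
    obtain n i \<sigma> where "n \<ge> Suc (length v)" "i \<le> n - Suc (length v)"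
      "\<sigma> \<in> symmetry_group n w" "contains_independent_cycle {..<n} \<sigma> [i..<i + Suc (length v)]"
      using assms(3)[of "Suc (length v)"] by auto
    then show ?thesis
      using factors_rotate_last[OF assms(2)] that by auto
  qed
  have rot: "v @ u \<in> factors w" if "u @ v \<in> factors w" for u v
    using that
  \<comment> \<open>The letters of \<open>v\<close> travel to the front one at a time, last letter
    first; \<open>u\<close> is general because it absorbs each moved letter.\<close>
  proof (induction v arbitrary: u rule: rev_induct)
    case (snoc a v)
    then show ?case
      using rot1[of "u @ v" a] snoc.IH[of "a # u"] by simp
  qed simp
  have append: "u @ v \<in> factors w" if u: "u \<in> factors w" and v: "v \<in> factors w" for u v
  proof -
    obtain k where k: "w [k \<rightarrow> k + length v] = v"
      using v by (auto simp: factors_iff)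
    \<comment> \<open>Starting \<open>u\<close> after the end of \<open>v\<close> avoids overlap;
      the gap \<open>w [k + length v \<rightarrow> l]\<close> is a possibly empty filler.\<close>
    obtain l where l: "l \<ge> k + length v" "w [l \<rightarrow> l + length u] = u"
      using recurrent_occurrence_ge[OF assms(2) u] .
    have "w [k \<rightarrow> l + length u] = (v @ w [k + length v \<rightarrow> l]) @ u"
      using k l subsequence_split[of k "k + length v" l w] subsequence_split[of k l "l + length u" w]
      by simp
    \<comment> \<open>Rotation brings \<open>u\<close> directly before \<open>v\<close> and the
      filler to the end, where it can be cut off.\<close>
    then have "u @ v @ w [k + length v \<rightarrow> l] \<in> factors w"
      using rot subsequence_in_factors by metis
    then show ?thesis
      using factors_appendD1[of "u @ v"] by simp
  qed
  have "u \<in> factors w" if "u \<in> lists (range w)" for u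
    using that
  proof (induction u)
    case Nil
    show ?case
      by (simp add: factors_iff)
  next
    case (Cons a u)
    then obtain k where "a = w k"
      by blast
    then have "[a] \<in> factors w"
      by (auto simp: factors_iff)
    then show ?case
      using append[of "[a]" u] Cons by simp
  qed
  moreover have "factors w \<subseteq> lists (range w)"
    by (auto simp: factors_def factors_of_length_def)
  ultimately show ?thesis
    unfolding universal_def by blast
qed

end
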